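(* Let $Q=-T\in\mathbb{R}^{N\times N}$, where $T_{ij}=-t_{ij}$ for $i\neq j$, $T_{ii}=\sum_{j\ne i}t_{ij}$, and $t_{ij}=t_{ji}\ge 0$ for all $i\ne j$. Let $H_n(s)$ be the transfer function of the nominal agent and let $\xi$ be a number between $0$ and $1$. Assume that the nominal system $\Sigma(H_n(s),Q)$ is stable and that $\|\Delta(s)\|_\infty\le\xi$. Then the perturbed system $\Sigma(H_n(s),Q,\Delta(s))$ is robustly stable if and only if $$\left\|\frac{\lambda_iH_n(s)}{1-\lambda_iH_n(s)}\right\|_\infty\le\frac1\xi\qquad\text{for all }\lambda_i\in\sigma_-(Q),$$ where $\sigma_-(Q)$ is the set of negative eigenvalues of $Q$.
   Context: $\|\cdot\|_\infty$ is the $H_\infty$ norm. $\Sigma(H_n(s),Q)$ is the homogeneous multi-agent feedback system $y=H_n(s)I_N\,u$, $u=Qy$; it is stable if and only if $H_n(s)\lambda_i\neq 1$ for all eigenvalues $\lambda_i$ of $Q$ and all $s\in\mathbb{C}_+$ (the closed right half-plane). $\Sigma(H_n(s),Q,\Delta(s))$ is obtained from it by introducing the multiplicative perturbation $\Delta(s)=\mathrm{diag}\{\Delta_1(s),\dots,\Delta_N(s)\}$, i.e. replacing the $i$-th agent $H_n(s)$ by $(1+\Delta_i(s))H_n(s)$. Robustly stable means stable for the perturbations $\Delta(s)$ with $\|\Delta(s)\|_\infty\le\xi$.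
   Formalization: Robust stability is taken over perturbations with ‖Δ(s)‖∞ < ξ instead of ≤ ξ, since with ≤ ξ the equivalence fails when the norm of the closed loop equals 1/ξ and is attained on the imaginary axis; transfer functions are real-rational. *)

theory Defs
  imports
    "HOL-Analysis.Analysis"
    "HOL-Computational_Algebra.Computational_Algebra"
    "HOL-Computational_Algebra.Field_as_Ring"
begin

type_synonym transfer_function = "real poly fract"

text \<open>
  A transfer function is evaluated through its representation in lowest terms, so common factors of
  numerator and denominator never matter. At a pole the value is the junk value 0 (division by 0).
\<close>

definition tf_eval :: "transfer_function \<Rightarrow> complex \<Rightarrow> complex" where
  "tf_eval G s =
     poly (map_poly of_real (fst (quot_of_fract G))) s /
     poly (map_poly of_real (snd (quot_of_fract G))) s"

definition tf_pole :: "transfer_function \<Rightarrow> complex \<Rightarrow> bool" where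
  "tf_pole G s \<longleftrightarrow> poly (map_poly of_real (snd (quot_of_fract G))) s = 0"

definition tf_const :: "real \<Rightarrow> transfer_function" where
  "tf_const c = to_fract [:c:]"

definition closed_rhp :: "complex set" where
  "closed_rhp = {s. 0 \<le> Re s}"

text \<open>
  The \<open>H\<^sub>\<infinity>\<close> norm is a supremum over the open right half-plane; for matrices the pointwise norm is the
  largest singular value. Being extended-real valued, it is infinite for a function that is improper
  or has a pole in the closed right half-plane: such a function is unbounded near the pole, so the
  junk value at the pole is harmless.
\<close>

definition Hinf_norm :: "transfer_function \<Rightarrow> ereal" where
  "Hinf_norm G = (SUP s \<in> {s. 0 < Re s}. ereal (cmod (tf_eval G s)))"

definition Hinf_norm_matrix :: "transfer_function^'m::finite^'n::finite \<Rightarrow> ereal" where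
  "Hinf_norm_matrix G =
     (SUP s \<in> {s. 0 < Re s}. ereal (onorm ((*v) (map_matrix (\<lambda>g. tf_eval g s) G))))"

definition diag_matrix :: "('n \<Rightarrow> 'a::zero) \<Rightarrow> 'a^'n^'n" where
  "diag_matrix d = (\<chi> i j. if i = j then d i else 0)"

definition eigenvalues :: "'a::field^'n^'n \<Rightarrow> 'a set" where
  "eigenvalues A = {l. \<exists>v. v \<noteq> 0 \<and> A *v v = l *s v}"

definition negative_eigenvalues :: "real^'n^'n \<Rightarrow> real set" where
  "negative_eigenvalues A = {l \<in> eigenvalues A. l < 0}"

text \<open>
  Stability of the homogeneous system \<open>y = H(s) I u\<close>, \<open>u = Q y\<close>. At a pole, \<open>H(s)\<close> is infinite and
  the condition \<open>H(s) l \<noteq> 1\<close> counts as satisfied.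
\<close>

definition stable_homogeneous :: "transfer_function \<Rightarrow> real^'n^'n \<Rightarrow> bool" where
  "stable_homogeneous H Q \<longleftrightarrow>
     (\<forall>l \<in> eigenvalues (map_matrix complex_of_real Q). \<forall>s \<in> closed_rhp.
        \<not> tf_pole H s \<longrightarrow> tf_eval H s * l \<noteq> 1)"

text \<open>
  Stability of \<open>y = diag(G\<^sub>i(s)) u\<close>, \<open>u = Q y\<close> for individual agents \<open>G\<^sub>i\<close>. It is only used for
  \<open>G\<^sub>i = (1 + \<Delta>\<^sub>i) H\<close> with \<open>\<Delta>\<^sub>i\<close> of norm less than 1; then all \<open>G\<^sub>i\<close> have exactly the poles of \<open>H\<close> in
  the closed right half-plane, and these points are treated as in the homogeneous case.
\<close>

definition stable_agents :: "('n::finite \<Rightarrow> transfer_function) \<Rightarrow> real^'n^'n \<Rightarrow> bool" where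
  "stable_agents G Q \<longleftrightarrow>
     (\<forall>s \<in> closed_rhp. (\<forall>i. \<not> tf_pole (G i) s) \<longrightarrow>
        det (mat 1 - diag_matrix (\<lambda>i. tf_eval (G i) s) ** map_matrix complex_of_real Q) \<noteq> 0)"

definition stable_perturbed ::
  "transfer_function \<Rightarrow> real^'n^'n \<Rightarrow> ('n::finite \<Rightarrow> transfer_function) \<Rightarrow> bool" where
  "stable_perturbed H Q \<Delta> \<longleftrightarrow> stable_agents (\<lambda>i. (1 + \<Delta> i) * H) Q"

text \<open>
  The ball of perturbations is open. With the closed ball, stability on the closed right half-plane
  would require the strict bound \<open>< 1/\<xi>\<close> on the nominal closed loop wherever the supremum is attained
  on the imaginary axis; the open ball is the one that corresponds to the non-strict bound \<open>\<le> 1/\<xi>\<close>.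
\<close>

definition robustly_stable :: "real \<Rightarrow> transfer_function \<Rightarrow> real^'n::finite^'n \<Rightarrow> bool" where
  "robustly_stable \<xi> H Q \<longleftrightarrow>
     (\<forall>\<Delta>. Hinf_norm_matrix (diag_matrix \<Delta>) < ereal \<xi> \<longrightarrow> stable_perturbed H Q \<Delta>)"

lemma stable_homogeneous_iff_stable_agents:
  fixes Q :: "real^'n::finite^'n"
  shows "stable_homogeneous H Q \<longleftrightarrow> stable_agents (\<lambda>_. H) Q"
proof -
  have *: "(\<forall>l \<in> eigenvalues A. h * l \<noteq> 1) \<longleftrightarrow> det (mat 1 - diag_matrix (\<lambda>_. h) ** A) \<noteq> 0"
    for A :: "complex^'n^'n" and h
  proof -
    have d: "diag_matrix (\<lambda>_. h) ** A = (\<chi> i. h *s (A $ i))"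
      by (simp add: vec_eq_iff matrix_matrix_mult_def diag_matrix_def if_distrib if_distribR cong: if_cong)
    have e: "(\<chi> i. h *s (A $ i)) *v v = h *s (A *v v)" for v
      by (simp add: vec_eq_iff matrix_vector_mult_def sum_distrib_left mult.assoc)
    have m: "(mat 1 - diag_matrix (\<lambda>_. h) ** A) *v v = v - h *s (A *v v)" for v
      using e by (simp add: d matrix_vector_mult_diff_rdistrib)
    have "det (mat 1 - diag_matrix (\<lambda>_. h) ** A) = 0 \<longleftrightarrow> (\<exists>v. v \<noteq> 0 \<and> v - h *s (A *v v) = 0)"
      using m invertible_det_nz[of "mat 1 - diag_matrix (\<lambda>_. h) ** A"]
        matrix_left_invertible_ker[of "mat 1 - diag_matrix (\<lambda>_. h) ** A"]
        invertible_left_inverse[of "mat 1 - diag_matrix (\<lambda>_. h) ** A"]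
      by auto
    also have "\<dots> \<longleftrightarrow> (\<exists>l \<in> eigenvalues A. h * l = 1)"
    proof
      assume "\<exists>v. v \<noteq> 0 \<and> v - h *s (A *v v) = 0"
      then obtain v where v: "v \<noteq> 0" "v = h *s (A *v v)" by auto
      then have h: "h \<noteq> 0" by auto
      have "(1 / h) *s v = (1 / h) *s (h *s (A *v v))" using v(2) by simp
      also have "\<dots> = A *v v" using h by (simp add: vector_smult_assoc)
      finally show "\<exists>l \<in> eigenvalues A. h * l = 1"
        using v(1) h by (intro bexI[of _ "1 / h"]) (auto simp: eigenvalues_def)
    next
      assume "\<exists>l \<in> eigenvalues A. h * l = 1"
      then show "\<exists>v. v \<noteq> 0 \<and> v - h *s (A *v v) = 0"
        by (auto simp: eigenvalues_def vector_smult_assoc)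
    qed
    finally show ?thesis by blast
  qed
  show ?thesis
    unfolding stable_homogeneous_def stable_agents_def using * by blast
qed

end

theory Submission
  imports Defs "HOL-Complex_Analysis.Complex_Analysis"
begin

text \<open>
  Sufficiency is a small-gain argument. If the perturbed loop is singular at \<open>s\<close>, with kernel vector
  \<open>v\<close>, put \<open>w = H(s) Q v\<close>; then \<open>v - w = \<Delta>(s) w\<close>, while an orthonormal eigenbasis of the symmetric
  matrix \<open>Q\<close> turns the bounds on the scalar closed loops into \<open>|w| \<le> |v - w| / \<xi>\<close>. Hence \<open>w = 0\<close> and \<open>v = 0\<close>.

  For necessity, nominal stability makes the closed loop \<open>G = \<lambda>H / (1 - \<lambda>H)\<close> pole-free in the closed
  right half-plane, so by the maximum principle it is enough to bound it on the imaginary axis. If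
  \<open>|G(i\<omega>)| > 1/\<xi>\<close>, let \<open>z = 1/G(i\<omega>)\<close>. The same perturbation \<open>\<delta>\<close> of all agents destabilises the
  eigenvalue \<open>\<lambda>\<close> as soon as \<open>\<delta>(i\<omega>) = z\<close>, and a real constant or a real first-order all-pass function
  \<open>c (s - r) / (s + r)\<close> of norm \<open>|z|\<close> takes this value. (At interior points of the half-plane such an
  interpolation with a real function is obstructed by the Nevanlinna-Pick condition, so the
  reduction to the axis is essential.) The condition \<open>\<xi> < 1\<close> rules out poles of \<open>H\<close>, where \<open>G = -1\<close>.
\<close>

section \<open>Evaluating real polynomials and their fractions at complex points\<close>

abbreviation cpoly :: "real poly \<Rightarrow> complex poly" where
  "cpoly \<equiv> map_poly complex_of_real"

lemma cpoly_add: "cpoly (p + q) = cpoly p + cpoly q"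
  by (rule poly_eqI) (simp add: coeff_map_poly)

lemma cpoly_diff: "cpoly (p - q) = cpoly p - cpoly q"
  by (rule poly_eqI) (simp add: coeff_map_poly)

lemma cpoly_mult: "cpoly (p * q) = cpoly p * cpoly q"
  by (rule poly_eqI) (simp add: coeff_map_poly coeff_mult)

lemma cpoly_smult: "cpoly (smult c p) = smult (complex_of_real c) (cpoly p)"
  by (rule map_poly_smult) auto

lemma cpoly_eq_0_iff: "cpoly p = 0 \<longleftrightarrow> p = 0"
  by (rule map_poly_eq_0_iff) auto

lemma poly_cpoly_of_real: "poly (cpoly p) (of_real x) = of_real (poly p x)"
  by (induction p) (auto simp: map_poly_pCons)

lemmas cpoly_simps = cpoly_add cpoly_diff cpoly_mult cpoly_smult

text \<open>A Bezout identity with real coefficients can be evaluated at a complex point, so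
  coprimality over the reals already excludes common complex roots.\<close>

lemma coprime_no_common_root:
  assumes "coprime p q" "poly (cpoly p) s = 0"
  shows "poly (cpoly q) s \<noteq> 0"
proof
  assume q: "poly (cpoly q) s = 0"
  have "fst (bezout_coefficients p q) * p + snd (bezout_coefficients p q) * q = 1"
    using assms(1) by (simp add: bezout_coefficients_fst_snd)
  from arg_cong[OF this, of "\<lambda>r. poly (cpoly r) s"] show False
    using q assms(2) by (simp add: cpoly_simps)
qed

lemma fract_times_denominator:
  "G * to_fract (snd (quot_of_fract G)) = to_fract (fst (quot_of_fract G))"
proof -
  have "G = to_fract (fst (quot_of_fract G)) / to_fract (snd (quot_of_fract G))"
    by (metis Fract_quot_of_fract Fract_conv_to_fract)
  then show ?thesis
    by (metis nonzero_eq_divide_eq snd_quot_of_fract_nonzero to_fract_eq_0_iff)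
qed

text \<open>Clearing denominators turns equality in the fraction field into an identity of
  polynomials, which can be evaluated at every complex point, poles included.\<close>

lemma cross_multiplied:
  fixes G :: transfer_function
  assumes "G * to_fract b = to_fract a"
  shows "fst (quot_of_fract G) * b = a * snd (quot_of_fract G)"
proof -
  let ?n = "fst (quot_of_fract G)" and ?d = "snd (quot_of_fract G)"
  have "to_fract ?n * to_fract b = (G * to_fract ?d) * to_fract b"
    by (simp only: fract_times_denominator)
  also have "\<dots> = (G * to_fract b) * to_fract ?d" by (simp only: ac_simps)
  also have "\<dots> = to_fract a * to_fract ?d" by (simp only: assms)
  finally show ?thesis by (simp flip: to_fract_mult)
qed

text \<open>Allows evaluation without finding lowest terms. If the reduced denominator vanished at
  \<open>s\<close>, the cross-multiplied identity and \<open>b\<close> being nonzero there would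
  make the reduced numerator vanish too, against coprimality.\<close>

lemma tf_eval_quotient:
  assumes "G * to_fract b = to_fract a" and b: "poly (cpoly b) s \<noteq> 0"
  shows "\<not> tf_pole G s" and "tf_eval G s = poly (cpoly a) s / poly (cpoly b) s"
proof -
  let ?n = "fst (quot_of_fract G)" and ?d = "snd (quot_of_fract G)"
  from cross_multiplied[OF assms(1)]
  have eq: "poly (cpoly ?n) s * poly (cpoly b) s = poly (cpoly a) s * poly (cpoly ?d) s"
    by (metis cpoly_mult poly_mult)
  show np: "\<not> tf_pole G s"
    unfolding tf_pole_def
    using eq b coprime_no_common_root[OF coprime_quot_of_fract[of G]] by auto
  show "tf_eval G s = poly (cpoly a) s / poly (cpoly b) s"
    using eq b np unfolding tf_eval_def tf_pole_def by (simp add: field_simps)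
qed

section \<open>Bounds carried over to the closed right half-plane\<close>

text \<open>Only the finitely many roots of \<open>q\<close> are exceptional, so \<open>s\<close> is
  approached horizontally from the right by points that avoid them, and continuity does the rest.
  The product form keeps its meaning at the roots of \<open>q\<close>.\<close>

lemma poly_norm_le_closed_rhp:
  fixes p q :: "complex poly"
  assumes "q \<noteq> 0" and le: "\<And>s. 0 < Re s \<Longrightarrow> poly q s \<noteq> 0 \<Longrightarrow> cmod (poly p s) \<le> c * cmod (poly q s)"
    and "0 \<le> Re s"
  shows "cmod (poly p s) \<le> c * cmod (poly q s)"
proof -
  have lim: "filterlim (\<lambda>e. s + of_real e) (at s) (at_right (0::real))"
    unfolding filterlim_at
    by (auto intro!: tendsto_eq_intros simp: eventually_at_filter)
  have "\<not> s islimpt {x. poly q x = 0}"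
    using poly_roots_finite[OF \<open>q \<noteq> 0\<close>] by (rule islimpt_finite)
  then have "eventually (\<lambda>x. poly q x \<noteq> 0) (at s)"
    by (simp add: islimpt_iff_eventually)
  then have "eventually (\<lambda>e. poly q (s + of_real e) \<noteq> 0) (at_right (0::real))"
    using lim by (rule eventually_compose_filterlim)
  moreover have "eventually (\<lambda>e. e > (0::real)) (at_right 0)"
    by (simp add: eventually_at_right_less)
  ultimately have ev: "eventually (\<lambda>e::real. cmod (poly p (s + of_real e)) \<le> c * cmod (poly q (s + of_real e))) (at_right 0)"
    by eventually_elim (use \<open>0 \<le> Re s\<close> in \<open>auto intro!: le\<close>)
  have lim': "((\<lambda>e. s + of_real e) \<longlongrightarrow> s) (at_right (0::real))"
    using lim by (simp add: filterlim_at)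
  show ?thesis
  proof (rule tendsto_le[OF _ _ _ ev])
    show "((\<lambda>e. cmod (poly p (s + of_real e))) \<longlongrightarrow> cmod (poly p s)) (at_right (0::real))"
      by (intro tendsto_norm isCont_tendsto_compose[OF _ lim']) auto
    show "((\<lambda>e. c * cmod (poly q (s + of_real e))) \<longlongrightarrow> c * cmod (poly q s)) (at_right (0::real))"
      by (intro tendsto_mult tendsto_const tendsto_norm isCont_tendsto_compose[OF _ lim']) auto
  qed auto
qed

text \<open>By the product form of the bound, a root of the denominator in the closed half-plane
  would be a root of the numerator as well, which coprimality forbids. So the value 0 assigned at
  poles cannot hide a pole from a finite norm.\<close>

lemma Hinf_norm_le_closed_rhp:
  assumes "Hinf_norm G \<le> ereal c" and "0 \<le> Re s"
  shows "\<not> tf_pole G s" and "cmod (tf_eval G s) \<le> c"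
proof -
  let ?n = "cpoly (fst (quot_of_fract G))" and ?d = "cpoly (snd (quot_of_fract G))"
  have le: "cmod (poly ?n s) \<le> c * cmod (poly ?d s)"
  proof (rule poly_norm_le_closed_rhp)
    show "?d \<noteq> 0" by (simp add: cpoly_eq_0_iff)
  next
    fix s assume s: "0 < Re s" "poly ?d s \<noteq> 0"
    have "ereal (cmod (tf_eval G s)) \<le> ereal c"
      using assms(1) s(1) unfolding Hinf_norm_def by (simp add: SUP_le_iff)
    then show "cmod (poly ?n s) \<le> c * cmod (poly ?d s)"
      using s(2) by (simp add: tf_eval_def norm_divide field_simps)
  qed fact
  show np: "\<not> tf_pole G s"
    using le coprime_no_common_root[OF coprime_quot_of_fract[of G]] by (auto simp: tf_pole_def)
  then show "cmod (tf_eval G s) \<le> c"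
    using le by (simp add: tf_eval_def tf_pole_def norm_divide field_simps)
qed

section \<open>The maximum principle for rational functions on the right half-plane\<close>

lemma filterlim_imaginary_axis: "filterlim (Complex 0) at_infinity at_top"
proof -
  have "filterlim (\<lambda>x. cmod (Complex 0 x)) at_top at_top"
    by (simp add: cmod_def filterlim_abs_real)
  then show ?thesis by (simp add: filterlim_norm_at_top_imp_at_infinity)
qed

lemma rational_tendsto_at_infinity:
  fixes a b :: "complex poly"
  assumes "degree a \<le> degree b" "b \<noteq> 0"
  shows "\<exists>L. ((\<lambda>s. poly a s / poly b s) \<longlongrightarrow> L) at_infinity"
proof (cases "degree a < degree b")
  case True
  then show ?thesis using poly_divide_tendsto_0_at_infinity by blast
next
  case False
  then have deg: "degree a = degree b" using assms by simp
  have "((\<lambda>s. (poly a s / s ^ degree a) / (poly b s / s ^ degree b)) \<longlongrightarrow> lead_coeff a / lead_coeff b) at_infinity"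
    using assms by (intro tendsto_divide poly_divide_tendsto_aux) auto
  moreover have "\<forall>\<^sub>F s in at_infinity. (poly a s / s ^ degree a) / (poly b s / s ^ degree b) = poly a s / poly b s"
    by (rule eventually_at_infinityI[of 1]) (auto simp: deg)
  ultimately show ?thesis by (auto dest: tendsto_cong)
qed

text \<open>The half-plane is unbounded, so infinity has to be controlled first. Boundedness on the
  axis forces \<open>degree a \<le> degree b\<close>; hence the quotient has a limit at infinity,
  and its modulus is at most \<open>c\<close> because the axis itself leads there. The usual maximum
  modulus principle then applies on large half-discs.\<close>

lemma rational_maximum_principle_rhp:
  fixes a b :: "complex poly"
  assumes b: "\<And>s. 0 \<le> Re s \<Longrightarrow> poly b s \<noteq> 0"
    and axis: "\<And>w. cmod (poly a (Complex 0 w) / poly b (Complex 0 w)) \<le> c"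
    and s: "0 \<le> Re s"
  shows "cmod (poly a s / poly b s) \<le> c"
proof -
  have b0: "b \<noteq> 0" using b[of 0] by auto
  have deg: "degree a \<le> degree b"
  proof (rule ccontr)
    assume "\<not> degree a \<le> degree b"
    then have ba: "((\<lambda>s. poly b s / poly a s) \<longlongrightarrow> 0) at_infinity"
      by (intro poly_divide_tendsto_0_at_infinity) simp
    \<comment> \<open>The quotient times its reciprocal is a bounded function times one tending to
      0, yet it equals 1 far out on the axis.\<close>
    have "((\<lambda>w. (poly a (Complex 0 w) / poly b (Complex 0 w)) * (poly b (Complex 0 w) / poly a (Complex 0 w))) \<longlongrightarrow> 0) at_top"
    proof (rule Lim_null_comparison)
      show "((\<lambda>w. c * norm (poly b (Complex 0 w) / poly a (Complex 0 w))) \<longlongrightarrow> 0) at_top"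
        by (intro tendsto_mult_right_zero tendsto_norm_zero filterlim_compose[OF ba filterlim_imaginary_axis])
      show "\<forall>\<^sub>F w in at_top. norm ((poly a (Complex 0 w) / poly b (Complex 0 w)) * (poly b (Complex 0 w) / poly a (Complex 0 w)))
          \<le> c * norm (poly b (Complex 0 w) / poly a (Complex 0 w))"
        unfolding norm_mult by (intro always_eventually allI mult_right_mono axis norm_ge_zero)
    qed
    moreover have "\<forall>\<^sub>F w in at_top. poly a (Complex 0 w) \<noteq> 0"
    proof -
      have "degree a > 0" using \<open>\<not> degree a \<le> degree b\<close> by simp
      then have "filterlim (\<lambda>w. poly a (Complex 0 w)) at_infinity at_top"
        by (intro filterlim_compose[OF filterlim_poly_at_infinity filterlim_imaginary_axis])
      then show ?thesis
        by (metis (mono_tags, lifting) eventually_mono filterlim_at_infinity_imp_eventually_ne)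
    qed
    then have "\<forall>\<^sub>F w in at_top. (poly a (Complex 0 w) / poly b (Complex 0 w)) * (poly b (Complex 0 w) / poly a (Complex 0 w)) = 1"
      by eventually_elim (use b in auto)
    ultimately have "((\<lambda>w::real. 1::complex) \<longlongrightarrow> 0) at_top"
      by (rule Lim_transform_eventually)
    then show False by (simp add: tendsto_const_iff)
  qed
  then obtain L where L: "((\<lambda>s. poly a s / poly b s) \<longlongrightarrow> L) at_infinity"
    using rational_tendsto_at_infinity b0 by blast
  have "cmod L \<le> c"
  proof (rule tendsto_upperbound)
    show "((\<lambda>w. cmod (poly a (Complex 0 w) / poly b (Complex 0 w))) \<longlongrightarrow> cmod L) at_top"
      by (intro tendsto_norm filterlim_compose[OF L filterlim_imaginary_axis])
  qed (use axis in auto)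
  show ?thesis
  proof (rule field_le_epsilon)
    fix e :: real assume "0 < e"
    then have "\<forall>\<^sub>F s in at_infinity. dist (poly a s / poly b s) L < e"
      using L by (simp add: tendsto_iff)
    then obtain R where R: "\<And>s. R \<le> cmod s \<Longrightarrow> dist (poly a s / poly b s) L < e"
      by (auto simp: eventually_at_infinity)
    have far: "cmod (poly a s / poly b s) \<le> c + e" if "R \<le> cmod s" for s
      using R[OF that] \<open>cmod L \<le> c\<close> norm_triangle_ineq2[of "poly a s / poly b s" L]
      by (simp add: dist_norm)
    \<comment> \<open>This half-disc contains \<open>s\<close>, and each of its frontier points lies
      on the axis, where the bound is assumed, or so far out that the limit \<open>L\<close>
      controls the quotient.\<close>
    define S where "S = {s. 0 \<le> Re s} \<inter> cball 0 (max R (cmod s))"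
    have "closed S" unfolding S_def by (intro closed_Int closed_halfspace_Re_ge closed_cball)
    show "cmod (poly a s / poly b s) \<le> c + e"
    proof (rule maximum_modulus_frontier[of "\<lambda>s. poly a s / poly b s" S])
      show "(\<lambda>s. poly a s / poly b s) holomorphic_on interior S"
        using interior_subset[of S] b by (intro holomorphic_intros) (auto simp: S_def)
      show "continuous_on (closure S) (\<lambda>s. poly a s / poly b s)"
        using \<open>closed S\<close> b by (intro continuous_intros) (auto simp: S_def)
      show "bounded S" unfolding S_def by (auto intro: bounded_Int)
      show "s \<in> S" using s by (simp add: S_def)
      fix z assume z: "z \<in> frontier S"
      have "z \<in> S" using z \<open>closed S\<close> frontier_subset_closed by blast
      have "z \<notin> interior S" using z by (simp add: frontier_def)
      moreover have "{s. 0 < Re s} \<inter> ball 0 (max R (cmod s)) \<subseteq> interior S"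
        by (intro interior_maximal open_Int open_halfspace_Re_gt open_ball) (auto simp: S_def)
      ultimately consider "Re z = 0" | "R \<le> cmod z"
        using \<open>z \<in> S\<close> by (force simp: S_def)
      then show "cmod (poly a z / poly b z) \<le> c + e"
      proof cases
        case 1
        then have "z = Complex 0 (Im z)" by (simp add: complex_eq_iff)
        then show ?thesis using axis[of "Im z"] \<open>0 < e\<close> by simp
      next
        case 2 then show ?thesis by (rule far)
      qed
    qed
  qed
qed

section \<open>Interpolation on the imaginary axis by real all-pass functions\<close>

text \<open>A constant serves for real \<open>z\<close>. Otherwise
  \<open>c (s - r) / (s + r)\<close> with \<open>|c| = |z|\<close> and \<open>r > 0\<close> has
  modulus \<open>|z|\<close> on the axis and no larger one to its right, and \<open>r\<close>
  adjusts the phase at the given frequency. At frequency 0 real coefficients only yield real values,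
  whence the hypothesis.\<close>

lemma imaginary_axis_interpolant:
  fixes z :: complex
  assumes "w = 0 \<Longrightarrow> Im z = 0"
  obtains a b where "\<And>s. 0 \<le> Re s \<Longrightarrow> poly (cpoly b) s \<noteq> 0"
    "\<And>s. 0 \<le> Re s \<Longrightarrow> cmod (poly (cpoly a) s / poly (cpoly b) s) \<le> cmod z"
    "poly (cpoly a) (Complex 0 w) / poly (cpoly b) (Complex 0 w) = z"
proof (cases "Im z = 0")
  case True
  then show ?thesis
    by (intro that[of 1 "[:Re z:]"]) (auto simp: map_poly_pCons complex_eq_iff cmod_def)
next
  case False
  with assms have "w \<noteq> 0" by auto
  define c where "c = cmod z * sgn (w * Im z)"
  have c2: "c\<^sup>2 = (cmod z)\<^sup>2" using False \<open>w \<noteq> 0\<close> by (simp add: c_def power_mult_distrib power2_eq_square sgn_if)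
  have cabs: "\<bar>c\<bar> = cmod z" using False \<open>w \<noteq> 0\<close> by (simp add: c_def abs_mult abs_sgn_eq)
  have ne: "of_real c + z \<noteq> 0" using False by (auto simp: complex_eq_iff)
  \<comment> \<open>\<open>r\<close> solves \<open>z (i w + r) = c (i w - r)\<close>; the sign of \<open>c\<close> makes it positive\<close>
  define r where "r = 2 * (w * c * Im z) / (cmod (of_real c + z))\<^sup>2"
  have "r > 0"
  proof -
    have "w * c * Im z = cmod z * \<bar>w * Im z\<bar>" by (simp add: c_def abs_sgn algebra_simps)
    moreover have "cmod z * \<bar>w * Im z\<bar> > 0" using False \<open>w \<noteq> 0\<close> by (auto simp: complex_eq_iff)
    ultimately have "0 < 2 * (w * c * Im z)" by linarith
    then show ?thesis using ne unfolding r_def by (intro divide_pos_pos) auto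
  qed
  have nz: "s + of_real r \<noteq> 0" if "0 \<le> Re s" for s
    using that \<open>r > 0\<close> by (auto simp: complex_eq_iff)
  \<comment> \<open>Since \<open>c\<close> is real with \<open>c\<^sup>2 = |z|\<^sup>2\<close>, the
    product of \<open>c - z\<close> with the conjugate of \<open>c + z\<close> is
    \<open>- 2 i c Im z\<close>. This is why the solution \<open>i w (c - z) / (c + z)\<close> is
    the real number \<open>r\<close>.\<close>
  have key: "of_real r * (of_real c + z) = \<i> * of_real w * (of_real c - z)"
  proof -
    have "of_real r * (of_real c + z) * cnj (of_real c + z) = of_real (r * (cmod (of_real c + z))\<^sup>2)"
      by (simp only: of_real_mult complex_norm_square mult.assoc)
    also have "\<dots> = of_real (2 * (w * c * Im z))" using ne by (simp add: r_def)
    also have "\<dots> = \<i> * of_real w * (of_real c - z) * cnj (of_real c + z)"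
    proof -
      have "c * (c * w) = (cmod z)\<^sup>2 * w" unfolding c2[symmetric] by (simp add: power2_eq_square)
      also have "\<dots> = w * (Im z * Im z) + w * (Re z * Re z)"
        unfolding cmod_power2 by (simp add: power2_eq_square algebra_simps)
      finally show ?thesis by (simp add: complex_eq_iff algebra_simps)
    qed
    finally show ?thesis using ne by (metis complex_cnj_zero_iff mult_right_cancel)
  qed
  have num: "poly (cpoly (smult c [:-r, 1:])) s = of_real c * (s - of_real r)" for s
    by (simp add: map_poly_pCons cpoly_smult algebra_simps)
  have den: "poly (cpoly [:r, 1:]) s = s + of_real r" for s
    by (simp add: map_poly_pCons)
  show ?thesis
  proof (rule that[of "[:r, 1:]" "smult c [:-r, 1:]"]; unfold num den)
    fix s :: complex assume s: "0 \<le> Re s"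
    then show "s + of_real r \<noteq> 0" by (rule nz)
    \<comment> \<open>A point of the closed right half-plane is no farther from \<open>r\<close>
      than from \<open>-r\<close>.\<close>
    have "cmod (s - of_real r) \<le> cmod (s + of_real r)"
    proof (rule power2_le_imp_le)
      show "(cmod (s - of_real r))\<^sup>2 \<le> (cmod (s + of_real r))\<^sup>2"
        using s \<open>r > 0\<close> unfolding cmod_power2 by (simp add: power2_eq_square algebra_simps)
    qed simp
    then have "\<bar>c\<bar> * cmod (s - of_real r) \<le> \<bar>c\<bar> * cmod (s + of_real r)" by (rule mult_left_mono) simp
    then show "cmod (of_real c * (s - of_real r) / (s + of_real r)) \<le> cmod z"
      using nz[OF s] unfolding norm_divide norm_mult by (simp add: divide_le_eq cabs)
  next
    have "Complex 0 w + of_real r \<noteq> 0" by (rule nz) simp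
    then show "of_real c * (Complex 0 w - of_real r) / (Complex 0 w + of_real r) = z"
      using key by (simp add: field_simps Complex_eq)
  qed
qed

section \<open>Orthonormal eigenbases of real symmetric matrices\<close>

text \<open>The quadratic form of \<open>A\<close> attains its maximum on the unit sphere of
  \<open>S\<close>. A maximiser is an eigenvector, since otherwise a small step along its residual,
  which stays in \<open>S\<close> by invariance, would increase the Rayleigh quotient.\<close>

lemma symmetric_matrix_has_eigenvector:
  fixes A :: "real^'n^'n"
  assumes sym: "\<And>x y. (A *v x) \<bullet> y = x \<bullet> (A *v y)"
    and S: "subspace S" and inv: "\<And>x. x \<in> S \<Longrightarrow> A *v x \<in> S" and ne: "S \<noteq> {0}"
  obtains v l where "v \<in> S" "norm v = 1" "A *v v = l *\<^sub>R v"
proof -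
  let ?K = "S \<inter> sphere 0 1"
  have "compact ?K"
    using closed_subspace[OF S] by (simp add: closed_Int_compact)
  obtain u where u: "u \<in> S" "u \<noteq> 0" using ne subspace_0[OF S] by auto
  then have "sgn u \<in> ?K" using S by (auto simp: sgn_div_norm subspace_scale)
  then have "?K \<noteq> {}" by blast
  moreover have "continuous_on ?K (\<lambda>x. x \<bullet> (A *v x))"
    by (intro continuous_intros linear_continuous_on matrix_vector_mul_bounded_linear)
  ultimately have "\<exists>v\<in>?K. \<forall>x\<in>?K. x \<bullet> (A *v x) \<le> v \<bullet> (A *v v)"
    by (rule continuous_attains_sup[OF \<open>compact ?K\<close>])
  then obtain v where v: "v \<in> ?K" and max: "\<And>x. x \<in> ?K \<Longrightarrow> x \<bullet> (A *v x) \<le> v \<bullet> (A *v v)"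
    by blast
  define l where "l = v \<bullet> (A *v v)"
  have le: "x \<bullet> (A *v x) \<le> l * (x \<bullet> x)" if "x \<in> S" for x
  proof (cases "x = 0")
    case False
    have "sgn x \<in> ?K" using that S False by (auto simp: sgn_div_norm subspace_scale)
    from max[OF this] have "inverse (norm x) * (inverse (norm x) * (x \<bullet> (A *v x))) \<le> l"
      by (simp add: sgn_div_norm l_def matrix_vector_mult_scaleR)
    then show ?thesis using False by (simp add: field_simps power2_norm_eq_inner[symmetric] power2_eq_square)
  qed simp
  define w where "w = A *v v - l *\<^sub>R v"
  have vv: "v \<bullet> v = 1" using v by (simp add: norm_eq_sqrt_inner)
  have wS: "w \<in> S" unfolding w_def using v S inv by (auto intro: subspace_diff subspace_scale)
  define b where "b = w \<bullet> (A *v w) - l * (w \<bullet> w)"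
  \<comment> \<open>first variation of the Rayleigh quotient at its maximum, in the direction of the residual\<close>
  have var: "2 * t * (w \<bullet> w) + t\<^sup>2 * b \<le> 0" for t
  proof -
    have "v + t *\<^sub>R w \<in> S" using v wS S by (auto intro: subspace_add subspace_scale)
    from le[OF this] have "2 * t * (w \<bullet> (A *v v)) + t\<^sup>2 * (w \<bullet> (A *v w)) \<le> l * (2 * t * (w \<bullet> v) + t\<^sup>2 * (w \<bullet> w))"
      using sym[of v w] vv
      by (simp add: algebra_simps matrix_vector_mult_scaleR matrix_vector_right_distrib inner_commute power2_eq_square flip: l_def)
    moreover have "w \<bullet> (A *v v) = w \<bullet> w + l * (w \<bullet> v)"
      by (simp add: w_def inner_diff_right inner_diff_left)
    ultimately have "2 * t * (w \<bullet> w + l * (w \<bullet> v)) + t\<^sup>2 * (w \<bullet> (A *v w))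
        \<le> l * (2 * t * (w \<bullet> v) + t\<^sup>2 * (w \<bullet> w))" by (simp only:)
    then show ?thesis by (simp add: b_def algebra_simps)
  qed
  have "w = 0"
  proof (rule ccontr)
    assume "w \<noteq> 0"
    then have pos: "w \<bullet> w > 0" by simp
    \<comment> \<open>Small enough for the linear term of the variation to dominate the quadratic
      one; the summand 1 keeps the denominator positive.\<close>
    define t where "t = (w \<bullet> w) / (\<bar>b\<bar> + 1)"
    have "t > 0" using pos by (simp add: t_def)
    have "t * \<bar>b\<bar> \<le> w \<bullet> w" using pos by (simp add: t_def field_simps)
    then have "- (t * b) \<le> w \<bullet> w" using \<open>t > 0\<close> by (smt (verit) mult_minus_right mult_left_mono)
    then have "2 * (w \<bullet> w) + t * b > 0" using pos by linarith
    then have "t * (2 * (w \<bullet> w) + t * b) > 0" using \<open>t > 0\<close> by simp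
    then show False using var[of t] by (simp add: algebra_simps power2_eq_square)
  qed
  then have "A *v v = l *\<^sub>R v" by (simp add: w_def)
  with v show ?thesis using that by auto
qed

text \<open>Invariant subspaces make an induction on the dimension possible: after a unit
  eigenvector is split off, symmetry makes its orthogonal complement in \<open>S\<close> invariant
  again.\<close>

lemma symmetric_matrix_orthonormal_eigenbasis_subspace:
  fixes A :: "real^'n^'n"
  assumes sym: "\<And>x y. (A *v x) \<bullet> y = x \<bullet> (A *v y)"
    and "subspace S" and "\<And>x. x \<in> S \<Longrightarrow> A *v x \<in> S"
  shows "\<exists>B. finite B \<and> pairwise orthogonal B \<and> (\<forall>b\<in>B. norm b = 1 \<and> (\<exists>l. A *v b = l *\<^sub>R b)) \<and> span B = S"
  using assms(2,3)
proof (induction "dim S" arbitrary: S rule: less_induct)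
  case (less S)
  show ?case
  proof (cases "S = {0}")
    case True
    then show ?thesis by (intro exI[of _ "{}"]) auto
  next
    case False
    obtain v l where v: "v \<in> S" "norm v = 1" "A *v v = l *\<^sub>R v"
      using symmetric_matrix_has_eigenvector[OF sym less.prems False] by metis
    have vv: "v \<bullet> v = 1" using v by (simp add: norm_eq_sqrt_inner)
    let ?S' = "{x \<in> S. v \<bullet> x = 0}"
    have sub: "subspace ?S'"
      using less.prems(1) by (auto simp: subspace_def inner_add_right)
    have "v \<notin> ?S'" using vv by auto
    then have "?S' \<subset> S" using v by blast
    then have "dim ?S' < dim S"
      by (intro dim_psubset) (simp only: span_eq_iff[THEN iffD2, OF sub] span_eq_iff[THEN iffD2, OF less.prems(1)])
    moreover have "A *v x \<in> ?S'" if "x \<in> ?S'" for x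
      using that less.prems(2) sym[of v x] v(3) by auto
    ultimately obtain B where B: "finite B" "pairwise orthogonal B"
      "\<forall>b\<in>B. norm b = 1 \<and> (\<exists>l. A *v b = l *\<^sub>R b)" "span B = ?S'"
      using less.hyps[OF _ sub] by auto
    have orth: "v \<bullet> b = 0" if "b \<in> B" for b
      using that B(4) span_base[of b B] by auto
    show ?thesis
    proof (intro exI[of _ "insert v B"] conjI)
      show "pairwise orthogonal (insert v B)"
        using B(2) orth by (auto simp: pairwise_insert orthogonal_def inner_commute)
      show "span (insert v B) = S"
      proof
        show "span (insert v B) \<subseteq> S"
          using v B(4) less.prems(1) span_superset[of B] by (intro span_minimal) auto
        show "S \<subseteq> span (insert v B)"
        proof
          fix x assume x: "x \<in> S"
          have "x - (v \<bullet> x) *\<^sub>R v \<in> ?S'"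
            using x v vv less.prems(1) by (auto simp: inner_diff_right intro: subspace_diff subspace_scale)
          then show "x \<in> span (insert v B)" using B(4) by (auto simp: span_insert)
        qed
      qed
    qed (use B v in auto)
  qed
qed

lemma symmetric_matrix_orthonormal_eigenbasis:
  fixes A :: "real^'n^'n"
  assumes "\<And>x y. (A *v x) \<bullet> y = x \<bullet> (A *v y)"
  obtains B where "finite B" "pairwise orthogonal B" "span B = UNIV"
    "\<And>b. b \<in> B \<Longrightarrow> norm b = 1" "\<And>b. b \<in> B \<Longrightarrow> \<exists>l. A *v b = l *\<^sub>R b"
  using symmetric_matrix_orthonormal_eigenbasis_subspace[OF assms subspace_UNIV] that by auto

lemma orthonormal_basis_norm_square:
  fixes x :: "'a::euclidean_space"
  assumes "finite B" "pairwise orthogonal B" "span B = UNIV" "\<And>b. b \<in> B \<Longrightarrow> norm b = 1"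
  shows "(norm x)\<^sup>2 = (\<Sum>b\<in>B. (x \<bullet> b)\<^sup>2)"
proof -
  have "x = (\<Sum>b\<in>B. (x \<bullet> b) *\<^sub>R b)"
    using orthonormal_basis_expand[of B x] assms by simp
  then have "x \<bullet> x = x \<bullet> (\<Sum>b\<in>B. (x \<bullet> b) *\<^sub>R b)" by simp
  then show ?thesis unfolding power2_norm_eq_inner by (simp add: inner_sum_right power2_eq_square)
qed

text \<open>Parseval for the real and the imaginary part separately. The basis vectors are real, so
  the coefficients need no conjugation.\<close>

lemma orthonormal_basis_norm_square_complex:
  fixes x :: "complex^'n"
  assumes "finite B" "pairwise orthogonal B" "span B = (UNIV :: (real^'n) set)" "\<And>b. b \<in> B \<Longrightarrow> norm b = 1"
  shows "(norm x)\<^sup>2 = (\<Sum>b\<in>B. (cmod (\<Sum>i\<in>UNIV. of_real ((b::real^'n) $ i) * x $ i))\<^sup>2)"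
proof -
  define u v :: "real^'n" where "u = (\<chi> i. Re (x $ i))" and "v = (\<chi> i. Im (x $ i))"
  have "(norm x)\<^sup>2 = (norm u)\<^sup>2 + (norm v)\<^sup>2"
    by (simp add: norm_vec_def L2_set_def real_sqrt_pow2 sum_nonneg cmod_power2 sum.distrib u_def v_def)
  also have "\<dots> = (\<Sum>b\<in>B. (u \<bullet> b)\<^sup>2 + (v \<bullet> b)\<^sup>2)"
    using orthonormal_basis_norm_square[OF assms] by (simp add: sum.distrib)
  also have "\<dots> = (\<Sum>b\<in>B. (cmod (\<Sum>i\<in>UNIV. of_real ((b::real^'n) $ i) * x $ i))\<^sup>2)"
    by (intro sum.cong) (simp_all add: cmod_power2 inner_vec_def u_def v_def mult.commute)
  finally show ?thesis .
qed

text \<open>In an orthonormal eigenbasis of \<open>A\<close> both vectors are obtained from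
  \<open>x\<close> by scaling the coordinates, with factors \<open>h l\<close> and
  \<open>1 - h l\<close>. The scalar inequalities therefore hold coordinatewise, and Parseval sums
  their squares.\<close>

lemma symmetric_matrix_eigenvalue_norm_le:
  fixes A :: "real^'n^'n" and x :: "complex^'n"
  assumes sym: "\<And>i j. A $ i $ j = A $ j $ i"
    and le: "\<And>l v. v \<noteq> 0 \<Longrightarrow> A *v v = l *s v \<Longrightarrow> cmod (h * of_real l) \<le> c * cmod (1 - h * of_real l)"
    and "0 \<le> c"
  defines "M \<equiv> map_matrix complex_of_real A"
  shows "norm (h *s (M *v x)) \<le> c * norm (x - h *s (M *v x))"
proof -
  have "transpose A = A" using sym by (simp add: transpose_def vec_eq_iff)
  then have "(A *v x) \<bullet> y = x \<bullet> (A *v y)" for x y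
    by (metis dot_lmul_matrix vector_transpose_matrix)
  then obtain B where B: "finite B" "pairwise orthogonal B" "span B = UNIV"
    "\<And>b. b \<in> B \<Longrightarrow> norm b = 1" and eig: "\<And>b. b \<in> B \<Longrightarrow> \<exists>l. A *v b = l *\<^sub>R b"
    using symmetric_matrix_orthonormal_eigenbasis by metis
  let ?c = "\<lambda>(b::real^'n) (y::complex^'n). \<Sum>i\<in>UNIV. complex_of_real (b $ i) * y $ i"
  have coef: "?c b (M *v x) = of_real l * ?c b x" if "A *v b = l *\<^sub>R b" for b l
  proof -
    have "?c b (M *v x) = (\<Sum>i\<in>UNIV. \<Sum>j\<in>UNIV. of_real (b $ i * A $ i $ j) * x $ j)"
      by (simp add: M_def matrix_vector_mult_def map_matrix_def sum_distrib_left mult.assoc)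
    \<comment> \<open>Exchanging the sums and using symmetry moves the matrix from \<open>x\<close>
      to the eigenvector \<open>b\<close>.\<close>
    also have "\<dots> = (\<Sum>j\<in>UNIV. \<Sum>i\<in>UNIV. of_real (A $ j $ i * b $ i) * x $ j)"
      by (subst sum.swap) (metis (no_types, lifting) mult.commute sum.cong sym)
    also have "\<dots> = (\<Sum>j\<in>UNIV. of_real ((A *v b) $ j) * x $ j)"
      by (simp add: matrix_vector_mult_def sum_distrib_right)
    also have "\<dots> = of_real l * ?c b x"
      by (simp add: that sum_distrib_left mult.assoc)
    finally show ?thesis .
  qed
  have parseval: "(norm y)\<^sup>2 = (\<Sum>b\<in>B. (cmod (?c b y))\<^sup>2)" for y
    by (rule orthonormal_basis_norm_square_complex[OF B])
  have "(norm (h *s (M *v x)))\<^sup>2 \<le> (c * norm (x - h *s (M *v x)))\<^sup>2"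
    unfolding power_mult_distrib parseval sum_distrib_left
  proof (rule sum_mono)
    fix b assume "b \<in> B"
    then obtain l where l: "A *v b = l *\<^sub>R b" using eig by blast
    have "b \<noteq> 0" using B(4)[OF \<open>b \<in> B\<close>] by auto
    have "?c b (h *s (M *v x)) = h * ?c b (M *v x)"
      by (simp add: sum_distrib_left mult.left_commute)
    then have 1: "?c b (h *s (M *v x)) = h * of_real l * ?c b x"
      unfolding coef[OF l] by (simp only: mult.assoc)
    have "?c b (x - h *s (M *v x)) = ?c b x - ?c b (h *s (M *v x))"
      by (simp add: right_diff_distrib sum_subtractf)
    then have 2: "?c b (x - h *s (M *v x)) = (1 - h * of_real l) * ?c b x"
      unfolding 1 by (simp add: algebra_simps)
    have "A *v b = l *s b" using l by (simp add: scalar_mult_eq_scaleR)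
    from le[OF \<open>b \<noteq> 0\<close> this]
    have "cmod (h * of_real l) * cmod (?c b x) \<le> (c * cmod (1 - h * of_real l)) * cmod (?c b x)"
      by (rule mult_right_mono) (rule norm_ge_zero)
    then have "cmod (h * of_real l * ?c b x) \<le> c * cmod ((1 - h * of_real l) * ?c b x)"
      by (simp only: norm_mult mult.assoc)
    then have "(cmod (h * of_real l * ?c b x))\<^sup>2 \<le> (c * cmod ((1 - h * of_real l) * ?c b x))\<^sup>2"
      by (rule power_mono) (rule norm_ge_zero)
    then show "(cmod (?c b (h *s (M *v x))))\<^sup>2 \<le> c\<^sup>2 * (cmod (?c b (x - h *s (M *v x))))\<^sup>2"
      unfolding 1 2 by (simp only: power_mult_distrib)
  qed
  then show ?thesis by (rule power2_le_imp_le) (simp add: \<open>0 \<le> c\<close>)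
qed

section \<open>Perturbed agents and closed loops as fractions\<close>

lemma tf_times_denominator_plus_one:
  fixes D :: transfer_function
  assumes "D * to_fract b = to_fract a" and "H * to_fract q = to_fract p"
  shows "(1 + D) * H * to_fract (b * q) = to_fract ((b + a) * p)"
proof -
  have "(1 + D) * H * to_fract (b * q) = (to_fract b + D * to_fract b) * (H * to_fract q)"
    by (simp add: algebra_simps)
  then show ?thesis by (simp only: assms flip: to_fract_add to_fract_mult)
qed

lemma perturbed_agent_eval:
  assumes "\<not> tf_pole D s" and "\<not> tf_pole H s"
  shows "\<not> tf_pole ((1 + D) * H) s"
    and "tf_eval ((1 + D) * H) s = (1 + tf_eval D s) * tf_eval H s"
proof -
  note eq = tf_times_denominator_plus_one[OF fract_times_denominator[of D] fract_times_denominator[of H]]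
  have nz: "poly (cpoly (snd (quot_of_fract D) * snd (quot_of_fract H))) s \<noteq> 0"
    using assms by (simp add: tf_pole_def cpoly_mult)
  show "\<not> tf_pole ((1 + D) * H) s" by (rule tf_eval_quotient(1)[OF eq nz])
  show "tf_eval ((1 + D) * H) s = (1 + tf_eval D s) * tf_eval H s"
    unfolding tf_eval_quotient(2)[OF eq nz]
    using assms by (simp add: tf_pole_def tf_eval_def cpoly_simps field_simps)
qed

text \<open>The factor \<open>1 + D\<close> is nonzero at \<open>s\<close>, so it cannot cancel the
  pole: in the cross-multiplied identity one side vanishes with the denominator of \<open>H\<close>,
  and on the other side only the denominator of the product can vanish.\<close>

lemma perturbed_agent_pole:
  assumes D: "\<not> tf_pole D s" "tf_eval D s \<noteq> - 1" and "tf_pole H s"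
  shows "tf_pole ((1 + D) * H) s"
proof -
  let ?a = "fst (quot_of_fract D)" and ?b = "snd (quot_of_fract D)"
  let ?p = "fst (quot_of_fract H)" and ?q = "snd (quot_of_fract H)"
  let ?F = "(1 + D) * H"
  have "fst (quot_of_fract ?F) * (?b * ?q) = ((?b + ?a) * ?p) * snd (quot_of_fract ?F)"
    by (intro cross_multiplied tf_times_denominator_plus_one fract_times_denominator)
  from arg_cong[OF this, of "\<lambda>r. poly (cpoly r) s"]
  have "(poly (cpoly ?b) s + poly (cpoly ?a) s) * poly (cpoly ?p) s * poly (cpoly (snd (quot_of_fract ?F))) s = 0"
    using assms(3) by (simp add: cpoly_simps tf_pole_def)
  moreover have "poly (cpoly ?p) s \<noteq> 0"
    using assms(3) coprime_no_common_root[OF coprime_quot_of_fract[of H]] by (auto simp: tf_pole_def)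
  moreover have "poly (cpoly ?b) s + poly (cpoly ?a) s \<noteq> 0"
    using D by (auto simp: tf_pole_def tf_eval_def field_simps eq_neg_iff_add_eq_0)
  ultimately show ?thesis by (simp add: tf_pole_def)
qed

text \<open>With \<open>H = p / q\<close> the closed loop is \<open>l p / (q - l p)\<close>, where
  poles of \<open>H\<close> have disappeared. At such a pole \<open>q\<close> vanishes but
  \<open>l p\<close> does not; elsewhere \<open>q - l p\<close> is nonzero by nominal stability. In
  particular \<open>1 - l H\<close> is not the zero fraction, so the division is genuine.\<close>

lemma closed_loop_quotient:
  fixes H :: transfer_function and l :: real
  defines "p \<equiv> fst (quot_of_fract H)" and "q \<equiv> snd (quot_of_fract H)"
  assumes "l \<noteq> 0" and "\<not> tf_pole H s \<longrightarrow> tf_eval H s * of_real l \<noteq> 1"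
  shows "poly (cpoly (q - smult l p)) s \<noteq> 0"
    and "tf_const l * H / (1 - tf_const l * H) * to_fract (q - smult l p) = to_fract (smult l p)"
proof -
  show nz: "poly (cpoly (q - smult l p)) s \<noteq> 0"
  proof (cases "tf_pole H s")
    case True
    then show ?thesis
      using \<open>l \<noteq> 0\<close> coprime_no_common_root[OF coprime_quot_of_fract[of H], of s]
      by (auto simp: tf_pole_def p_def q_def cpoly_simps)
  next
    case False
    then show ?thesis
      using assms(4) by (auto simp: tf_pole_def tf_eval_def p_def q_def cpoly_simps field_simps)
  qed
  have sm: "to_fract (smult l p) = tf_const l * to_fract p"
    by (simp add: tf_const_def flip: to_fract_mult)
  have Hq: "H * to_fract q = to_fract p" unfolding p_def q_def by (rule fract_times_denominator)
  have eq: "(1 - tf_const l * H) * to_fract q = to_fract (q - smult l p)"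
    by (simp add: sm left_diff_distrib mult.assoc Hq)
  have "q - smult l p \<noteq> 0" using nz by auto
  then have ne: "1 - tf_const l * H \<noteq> 0" using eq by auto
  have "tf_const l * H / (1 - tf_const l * H) * ((1 - tf_const l * H) * to_fract q) = tf_const l * (H * to_fract q)"
    using ne by (simp add: field_simps)
  then show "tf_const l * H / (1 - tf_const l * H) * to_fract (q - smult l p) = to_fract (smult l p)"
    unfolding eq sm Hq .
qed

section \<open>Norms of diagonal matrices\<close>

lemma diag_matrix_mult_nth: "(diag_matrix d *v x) $ i = d i * x $ i"
  for d :: "'n::finite \<Rightarrow> complex"
  by (simp add: diag_matrix_def matrix_vector_mult_def if_distrib if_distribR cong: if_cong)

lemma tf_eval_0: "tf_eval 0 s = 0"
  by (simp add: tf_eval_def)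

lemma map_matrix_tf_eval_diag:
  "map_matrix (\<lambda>g. tf_eval g s) (diag_matrix \<Delta>) = diag_matrix (\<lambda>i. tf_eval (\<Delta> i) s)"
  by (simp add: vec_eq_iff map_matrix_def diag_matrix_def tf_eval_0)

lemma norm_vec_le_componentwise:
  fixes x y :: "complex^'n"
  assumes "0 \<le> c" and "\<And>i. cmod (y $ i) \<le> c * cmod (x $ i)"
  shows "norm y \<le> c * norm x"
  unfolding norm_vec_def L2_set_right_distrib[OF assms(1)]
  by (rule L2_set_mono) (use assms in auto)

lemma onorm_diag_matrix_le:
  assumes "0 \<le> c" and "\<And>i. cmod (d i) \<le> c"
  shows "onorm ((*v) (diag_matrix d)) \<le> c"
  using assms
  by (intro onorm_bound norm_vec_le_componentwise) (auto simp: diag_matrix_mult_nth norm_mult intro!: mult_right_mono)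

lemma cmod_le_onorm_diag_matrix: "cmod (d i) \<le> onorm ((*v) (diag_matrix d))"
  for d :: "'n::finite \<Rightarrow> complex"
proof -
  have "cmod (d i) = cmod ((diag_matrix d *v axis i 1) $ i)"
    by (simp add: diag_matrix_mult_nth)
  also have "\<dots> \<le> norm (diag_matrix d *v axis i 1)" by (rule Finite_Cartesian_Product.norm_nth_le)
  also have "\<dots> \<le> onorm ((*v) (diag_matrix d)) * norm (axis i (1::complex))"
    by (rule onorm) (rule matrix_vector_mul_bounded_linear)
  also have "norm (axis i (1::complex)) = 1" by simp
  finally show ?thesis by simp
qed

lemma Hinf_norm_le_diag: "Hinf_norm (\<Delta> i) \<le> Hinf_norm_matrix (diag_matrix \<Delta>)"
  unfolding Hinf_norm_def Hinf_norm_matrix_def map_matrix_tf_eval_diag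
  by (rule SUP_mono) (auto intro: cmod_le_onorm_diag_matrix)

lemma Hinf_norm_matrix_diag_le:
  assumes "0 \<le> c" and "\<And>i s. 0 < Re s \<Longrightarrow> cmod (tf_eval (\<Delta> i) s) \<le> c"
  shows "Hinf_norm_matrix (diag_matrix \<Delta>) \<le> ereal c"
  unfolding Hinf_norm_matrix_def map_matrix_tf_eval_diag
  using assms by (auto intro!: SUP_least onorm_diag_matrix_le)

section \<open>Kernels, eigenvalues and the graph Laplacian\<close>

lemma singular_matrix_kernel:
  fixes A :: "complex^'n^'n"
  assumes "det A = 0"
  obtains v where "v \<noteq> 0" "A *v v = 0"
  using assms invertible_det_nz[of A] matrix_left_invertible_ker[of A] invertible_left_inverse[of A]
  by auto

lemma eigenvalues_map_matrix_of_real: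
  fixes A :: "real^'n^'n"
  assumes "l \<in> eigenvalues A"
  shows "complex_of_real l \<in> eigenvalues (map_matrix complex_of_real A)"
proof -
  obtain v where v: "v \<noteq> 0" "A *v v = l *s v" using assms by (auto simp: eigenvalues_def)
  let ?v = "(\<chi> i. complex_of_real (v $ i)) :: complex^'n"
  have "?v \<noteq> 0" using v(1) by (simp add: vec_eq_iff)
  moreover have "map_matrix complex_of_real A *v ?v = (\<chi> i. complex_of_real ((A *v v) $ i))"
    by (simp add: vec_eq_iff matrix_vector_mult_def map_matrix_def)
  then have "map_matrix complex_of_real A *v ?v = complex_of_real l *s ?v"
    by (simp add: vec_eq_iff v(2))
  ultimately show ?thesis by (auto simp: eigenvalues_def)
qed

text \<open>A Gershgorin-type argument for the weighted graph Laplacian. In the row \<open>i\<close>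
  where \<open>|v $ i|\<close> is largest, the eigenvalue equation times \<open>v $ i\<close> writes
  \<open>l (v $ i)\<^sup>2\<close> as a sum of terms
  \<open>t i j ((v $ i)\<^sup>2 - v $ j * v $ i)\<close>, all nonnegative by the choice of
  \<open>i\<close>.\<close>

lemma laplacian_eigenvalue_nonneg:
  fixes T :: "real^'n^'n" and t :: "'n \<Rightarrow> 'n \<Rightarrow> real"
  assumes "\<And>i j. i \<noteq> j \<Longrightarrow> 0 \<le> t i j"
    and T: "T = (\<chi> i j. if i = j then (\<Sum>k\<in>UNIV - {i}. t i k) else - t i j)"
    and "v \<noteq> 0" and eig: "T *v v = l *s v"
  shows "0 \<le> l"
proof -
  have "Max (range (\<lambda>j. \<bar>v $ j\<bar>)) \<in> range (\<lambda>j. \<bar>v $ j\<bar>)" by (rule Max_in) auto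
  then obtain i where i: "Max (range (\<lambda>j. \<bar>v $ j\<bar>)) = \<bar>v $ i\<bar>" by (rule imageE)
  have max: "\<bar>v $ j\<bar> \<le> \<bar>v $ i\<bar>" for j unfolding i[symmetric] by (rule Max_ge) auto
  have "v $ i \<noteq> 0" using max \<open>v \<noteq> 0\<close> by (force simp: vec_eq_iff)
  have "(T *v v) $ i = T $ i $ i * v $ i + (\<Sum>j\<in>UNIV - {i}. T $ i $ j * v $ j)"
    by (simp add: matrix_vector_mult_def sum.remove[of UNIV i])
  also have "(\<Sum>j\<in>UNIV - {i}. T $ i $ j * v $ j) = (\<Sum>j\<in>UNIV - {i}. - (t i j * v $ j))"
    by (rule sum.cong) (auto simp: T)
  also have "T $ i $ i * v $ i = (\<Sum>j\<in>UNIV - {i}. t i j * v $ i)"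
    by (simp add: T sum_distrib_right)
  finally have "l * v $ i = (\<Sum>j\<in>UNIV - {i}. t i j * (v $ i - v $ j))"
    by (simp add: eig right_diff_distrib sum_subtractf sum_negf)
  then have "l * (v $ i)\<^sup>2 = (\<Sum>j\<in>UNIV - {i}. t i j * ((v $ i)\<^sup>2 - v $ j * v $ i))"
    by (simp add: power2_eq_square sum_distrib_right left_diff_distrib mult.assoc flip: mult.assoc[of l])
  also have "\<dots> \<ge> 0"
  proof (intro sum_nonneg mult_nonneg_nonneg)
    fix j
    have "v $ j * v $ i \<le> \<bar>v $ j\<bar> * \<bar>v $ i\<bar>" by (simp flip: abs_mult)
    also have "\<dots> \<le> \<bar>v $ i\<bar> * \<bar>v $ i\<bar>" using max[of j] by (rule mult_right_mono) simp
    finally show "0 \<le> (v $ i)\<^sup>2 - v $ j * v $ i" by (simp add: power2_eq_square)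
  qed (use assms(1) in auto)
  finally show ?thesis using \<open>v $ i \<noteq> 0\<close> by (simp add: zero_le_mult_iff)
qed

section \<open>The small-gain direction and the interpolation direction\<close>

lemma robustly_stable_if_closed_loop_bound:
  fixes Q :: "real^'n::finite^'n"
  assumes sym: "\<And>i j. Q $ i $ j = Q $ j $ i"
    and neg: "\<And>l v. v \<noteq> 0 \<Longrightarrow> Q *v v = l *s v \<Longrightarrow> l \<le> 0"
    and xi: "0 < \<xi>" "\<xi> < 1"
    and stable: "stable_homogeneous H Q"
    and bound: "\<And>l. l \<in> negative_eigenvalues Q \<Longrightarrow>
      Hinf_norm (tf_const l * H / (1 - tf_const l * H)) \<le> ereal (1 / \<xi>)"
  shows "robustly_stable \<xi> H Q"
  unfolding robustly_stable_def stable_perturbed_def stable_agents_def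
proof (intro allI impI ballI notI)
  fix \<Delta> :: "'n \<Rightarrow> transfer_function" and s
  define M where "M = map_matrix complex_of_real Q"
  assume norm: "Hinf_norm_matrix (diag_matrix \<Delta>) < ereal \<xi>" and "s \<in> closed_rhp"
    and np: "\<forall>i. \<not> tf_pole ((1 + \<Delta> i) * H) s"
    and "det (mat 1 - diag_matrix (\<lambda>i. tf_eval ((1 + \<Delta> i) * H) s) ** map_matrix complex_of_real Q) = 0"
  then obtain v where v: "v \<noteq> 0"
    "(mat 1 - diag_matrix (\<lambda>i. tf_eval ((1 + \<Delta> i) * H) s) ** M) *v v = 0"
    unfolding M_def using singular_matrix_kernel by blast
  have s: "0 \<le> Re s" using \<open>s \<in> closed_rhp\<close> by (simp add: closed_rhp_def)
  obtain c where c: "Hinf_norm_matrix (diag_matrix \<Delta>) < ereal c" "c < \<xi>"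
    using ereal_dense2[OF norm] by auto
  \<comment> \<open>The gap between \<open>c\<close> and \<open>\<xi>\<close> is what finally forces
    \<open>w = 0\<close>: the two norm estimates combine to
    \<open>\<xi> |w| \<le> c |w|\<close>.\<close>
  have "Hinf_norm (\<Delta> i) \<le> ereal c" for i
    using Hinf_norm_le_diag[of \<Delta> i] c(1) by simp
  note \<Delta> = Hinf_norm_le_closed_rhp[OF this s]
  have "0 \<le> c" using \<Delta>(2)[of undefined] norm_ge_zero order_trans by blast
  \<comment> \<open>As \<open>c < 1\<close>, no factor \<open>1 + \<Delta> i\<close> vanishes at
    \<open>s\<close>; a pole of \<open>H\<close> would thus persist in the perturbed agents, which
    \<open>np\<close> excludes.\<close>
  have ne: "tf_eval (\<Delta> i) s \<noteq> - 1" for i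
    using \<Delta>(2)[of i] c(2) xi by auto
  have H: "\<not> tf_pole H s"
    using np perturbed_agent_pole[OF \<Delta>(1) ne] by blast
  define h where "h = tf_eval H s"
  define w where "w = h *s (M *v v)"
  have vi: "v $ i - w $ i = tf_eval (\<Delta> i) s * w $ i" for i
  proof -
    have "v = diag_matrix (\<lambda>i. tf_eval ((1 + \<Delta> i) * H) s) *v (M *v v)"
      using v(2) by (simp add: matrix_vector_mult_diff_rdistrib matrix_vector_mul_assoc)
    then have "v $ i = (1 + tf_eval (\<Delta> i) s) * h * (M *v v) $ i"
      by (metis diag_matrix_mult_nth h_def perturbed_agent_eval(2)[OF \<Delta>(1) H])
    then show ?thesis by (simp add: w_def algebra_simps)
  qed
  have le1: "norm (v - w) \<le> c * norm w"
    by (rule norm_vec_le_componentwise)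
      (use \<open>0 \<le> c\<close> \<Delta>(2) in \<open>auto simp: vi norm_mult intro!: mult_right_mono\<close>)
  \<comment> \<open>The eigenvalue 0 has zero loop gain. Every other one is negative, and its
    closed-loop bound holds at \<open>s\<close> even if \<open>s\<close> lies on the imaginary
    axis.\<close>
  have "cmod (h * of_real l) \<le> 1 / \<xi> * cmod (1 - h * of_real l)"
    if "u \<noteq> 0" "Q *v u = l *s u" for l and u :: "real^'n"
  proof (cases "l = 0")
    case True
    then show ?thesis using xi by simp
  next
    case False
    then have l: "l \<in> negative_eigenvalues Q"
      using that neg[OF that] by (auto simp: negative_eigenvalues_def eigenvalues_def)
    then have "complex_of_real l \<in> eigenvalues (map_matrix complex_of_real Q)"
      by (auto simp: negative_eigenvalues_def intro: eigenvalues_map_matrix_of_real)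
    then have st: "\<not> tf_pole H s \<longrightarrow> tf_eval H s * of_real l \<noteq> 1"
      using stable \<open>s \<in> closed_rhp\<close> by (auto simp: stable_homogeneous_def)
    let ?p = "fst (quot_of_fract H)" and ?q = "snd (quot_of_fract H)"
    note G = closed_loop_quotient[OF False st]
    have q: "poly (cpoly ?q) s \<noteq> 0" using H by (simp add: tf_pole_def)
    have "tf_eval (tf_const l * H / (1 - tf_const l * H)) s
        = of_real l * poly (cpoly ?p) s / (poly (cpoly ?q) s - of_real l * poly (cpoly ?p) s)"
      using tf_eval_quotient(2)[OF G(2,1)] by (simp add: cpoly_simps)
    also have "\<dots> = h * of_real l / (1 - h * of_real l)"
      using q G(1) by (simp add: h_def tf_eval_def cpoly_simps divide_simps)
    finally have "cmod (h * of_real l / (1 - h * of_real l)) \<le> 1 / \<xi>"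
      using Hinf_norm_le_closed_rhp(2)[OF bound[OF l] s] by simp
    moreover have "1 - h * of_real l \<noteq> 0" using st H by (simp add: h_def)
    ultimately show ?thesis by (simp add: norm_divide pos_divide_le_eq)
  qed
  then have le2: "norm w \<le> 1 / \<xi> * norm (v - w)"
    unfolding w_def M_def using xi by (intro symmetric_matrix_eigenvalue_norm_le sym) auto
  have "\<xi> * norm w \<le> c * norm w"
    using le1 le2 xi by (simp add: field_simps)
  then have "w = 0" using c(2) by (simp add: mult_le_cancel_right)
  then show False using le1 v(1) by simp
qed

lemma closed_loop_bound_if_robustly_stable:
  fixes Q :: "real^'n::finite^'n"
  assumes xi: "0 < \<xi>" "\<xi> < 1"
    and stable: "stable_homogeneous H Q"
    and robust: "robustly_stable \<xi> H Q"
    and l: "l \<in> negative_eigenvalues Q"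
  shows "Hinf_norm (tf_const l * H / (1 - tf_const l * H)) \<le> ereal (1 / \<xi>)"
proof -
  have "l \<noteq> 0" using l by (simp add: negative_eigenvalues_def)
  have eig: "complex_of_real l \<in> eigenvalues (map_matrix complex_of_real Q)"
    using l by (auto simp: negative_eigenvalues_def intro: eigenvalues_map_matrix_of_real)
  define p q where "p = fst (quot_of_fract H)" and "q = snd (quot_of_fract H)"
  \<comment> \<open>The closed loop is \<open>a / b\<close>, and \<open>a + b\<close> is the
    denominator of \<open>H\<close>.\<close>
  define a b where "a = cpoly (smult l p)" and "b = cpoly (q - smult l p)"
  have st: "\<not> tf_pole H s \<longrightarrow> tf_eval H s * of_real l \<noteq> 1" if "0 \<le> Re s" for s
    using stable eig that by (auto simp: stable_homogeneous_def closed_rhp_def)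
  note G = closed_loop_quotient[OF \<open>l \<noteq> 0\<close> st, folded p_def q_def]
  have b: "poly b s \<noteq> 0" if "0 \<le> Re s" for s using G(1)[OF that] by (simp add: b_def)
  have axis: "cmod (poly a (Complex 0 w) / poly b (Complex 0 w)) \<le> 1 / \<xi>" for w
  proof (rule ccontr)
    let ?s = "Complex 0 w"
    define z where "z = poly b ?s / poly a ?s"
    assume "\<not> cmod (poly a ?s / poly b ?s) \<le> 1 / \<xi>"
    then have large: "1 / \<xi> < cmod (poly a ?s / poly b ?s)" by simp
    have "0 < 1 / \<xi>" using xi by simp
    then have "poly a ?s \<noteq> 0" using large by auto
    have "cmod z < \<xi>"
    proof -
      have "cmod z = inverse (cmod (poly a ?s / poly b ?s))" by (simp add: z_def norm_divide)
      also have "\<dots> < inverse (1 / \<xi>)" using large \<open>0 < 1 / \<xi>\<close> by (rule less_imp_inverse_less)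
      finally show ?thesis by simp
    qed
    have ba: "poly b ?s + poly a ?s = poly (cpoly q) ?s" by (simp add: a_def b_def cpoly_simps)
    have H: "\<not> tf_pole H ?s"
    proof
      assume "tf_pole H ?s"
      then have "poly (cpoly q) ?s = 0" by (simp add: tf_pole_def q_def)
      then have "poly b ?s = - poly a ?s" using ba by (simp add: eq_neg_iff_add_eq_0)
      then have "z = - 1" using \<open>poly a ?s \<noteq> 0\<close> by (simp add: z_def)
      then show False using \<open>cmod z < \<xi>\<close> xi by simp
    qed
    have im: "Im z = 0" if "w = 0"
    proof -
      have "Complex 0 w = of_real 0" using that by (simp add: complex_eq_iff)
      then show ?thesis unfolding z_def a_def b_def by (simp only: poly_cpoly_of_real flip: of_real_divide) simp
    qed
    obtain \<alpha> \<beta> where \<beta>: "\<And>s. 0 \<le> Re s \<Longrightarrow> poly (cpoly \<beta>) s \<noteq> 0"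
      and \<alpha>: "\<And>s. 0 \<le> Re s \<Longrightarrow> cmod (poly (cpoly \<alpha>) s / poly (cpoly \<beta>) s) \<le> cmod z"
      and z: "poly (cpoly \<alpha>) ?s / poly (cpoly \<beta>) ?s = z"
      by (rule imaginary_axis_interpolant[OF im]) (assumption | rule that)+
    define \<delta> where "\<delta> = to_fract \<alpha> / to_fract \<beta>"
    have "\<beta> \<noteq> 0" using \<beta>[of 0] by auto
    then have \<delta>: "\<delta> * to_fract \<beta> = to_fract \<alpha>" by (simp add: \<delta>_def)
    note ev = tf_eval_quotient[OF \<delta> \<beta>]
    have "Hinf_norm_matrix (diag_matrix (\<lambda>_::'n. \<delta>)) \<le> ereal (cmod z)"
      by (rule Hinf_norm_matrix_diag_le) (use ev(2) \<alpha> in auto)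
    also have "\<dots> < ereal \<xi>" using \<open>cmod z < \<xi>\<close> by simp
    finally have "stable_perturbed H Q (\<lambda>_. \<delta>)" using robust by (simp add: robustly_stable_def)
    \<comment> \<open>With one perturbation common to all agents the system is homogeneous again, so
      the eigenvalue \<open>l\<close> alone can be tested.\<close>
    then have "stable_homogeneous ((1 + \<delta>) * H) Q"
      by (simp add: stable_perturbed_def stable_homogeneous_iff_stable_agents)
    moreover have "?s \<in> closed_rhp" by (simp add: closed_rhp_def)
    moreover have \<delta>s: "\<not> tf_pole \<delta> ?s" "tf_eval \<delta> ?s = z" using ev[of ?s] z by auto
    ultimately have "tf_eval ((1 + \<delta>) * H) ?s * of_real l \<noteq> 1"
      unfolding stable_homogeneous_def using eig perturbed_agent_eval(1)[OF \<delta>s(1) H] by blast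
    then have "(1 + z) * tf_eval H ?s * of_real l \<noteq> 1"
      unfolding perturbed_agent_eval(2)[OF \<delta>s(1) H] \<delta>s(2) .
    \<comment> \<open>As \<open>z = b / a\<close>, the factor \<open>1 + z\<close> equals
      \<open>q / a\<close>, the reciprocal of the loop gain \<open>l H = a / q\<close>.\<close>
    moreover have "(1 + z) * tf_eval H ?s * of_real l = 1"
    proof -
      have "1 + z = poly (cpoly q) ?s / poly a ?s"
        using \<open>poly a ?s \<noteq> 0\<close> ba by (simp add: z_def field_simps)
      moreover have "tf_eval H ?s * of_real l = poly a ?s / poly (cpoly q) ?s"
        by (simp add: tf_eval_def p_def q_def a_def cpoly_simps)
      ultimately show ?thesis
        using \<open>poly a ?s \<noteq> 0\<close> H by (simp add: tf_pole_def q_def mult.assoc)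
    qed
    ultimately show False by simp
  qed
  show ?thesis
    unfolding Hinf_norm_def
  proof (rule SUP_least)
    fix s :: complex assume "s \<in> {s. 0 < Re s}"
    then have s: "0 \<le> Re s" by simp
    have "tf_eval (tf_const l * H / (1 - tf_const l * H)) s = poly a s / poly b s"
      using tf_eval_quotient(2)[OF G(2)[OF s] G(1)[OF s]] by (simp add: a_def b_def)
    then show "ereal (cmod (tf_eval (tf_const l * H / (1 - tf_const l * H)) s)) \<le> ereal (1 / \<xi>)"
      using rational_maximum_principle_rhp[OF b axis s] by simp
  qed
qed

theorem proposition7:
  fixes t :: "'n::finite \<Rightarrow> 'n \<Rightarrow> real"
    and T Q :: "real^'n^'n"
    and H :: transfer_function
    and \<xi> :: real
  assumes "\<And>i j. i \<noteq> j \<Longrightarrow> t i j = t j i"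
    and "\<And>i j. i \<noteq> j \<Longrightarrow> t i j \<ge> 0"
    and "T = (\<chi> i j. if i = j then (\<Sum>k\<in>UNIV - {i}. t i k) else - t i j)"
    and "Q = - T"
    and "0 < \<xi>" and "\<xi> < 1"
    and "stable_homogeneous H Q"
  shows "robustly_stable \<xi> H Q \<longleftrightarrow>
    (\<forall>l \<in> negative_eigenvalues Q.
       Hinf_norm (tf_const l * H / (1 - tf_const l * H)) \<le> ereal (1 / \<xi>))"
proof
  assume "robustly_stable \<xi> H Q"
  then show "\<forall>l \<in> negative_eigenvalues Q.
      Hinf_norm (tf_const l * H / (1 - tf_const l * H)) \<le> ereal (1 / \<xi>)"
    using closed_loop_bound_if_robustly_stable assms(5-7) by blast
next
  assume bound: "\<forall>l \<in> negative_eigenvalues Q.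
      Hinf_norm (tf_const l * H / (1 - tf_const l * H)) \<le> ereal (1 / \<xi>)"
  have sym: "Q $ i $ j = Q $ j $ i" for i j
    using assms(1)[of i j] by (auto simp: assms(3,4))
  \<comment> \<open>\<open>Q\<close> is the negative of a graph Laplacian, so the sign of its
    spectrum is reversed.\<close>
  have "l \<le> 0" if "v \<noteq> 0" "Q *v v = l *s v" for l and v :: "real^'n"
  proof -
    have "T = (- 1) *\<^sub>R Q" by (simp add: assms(4))
    then have "T *v v = (- 1) *\<^sub>R (Q *v v)" by (simp only: scaleR_matrix_vector_assoc)
    then have "T *v v = (- l) *s v" by (simp add: that(2) vec_eq_iff)
    from laplacian_eigenvalue_nonneg[OF assms(2,3) that(1) this] show ?thesis by simp
  qed
  then show "robustly_stable \<xi> H Q"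
    using robustly_stable_if_closed_loop_bound[OF sym _ assms(5-7)] bound by blast
qed

end
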